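(* Let $G=(V,E)$ be a finite amply regular $r$-regular graph with polynomial $p(x)=p_2x^2+p_1x+p_0$, and let $C\subset V$ be nonempty. If $\sigma(C)=a$ and $\sigma_2(C)\leq\beta$, then $$|C|\leq \frac{(\beta-p(a))|V|}{p_2(r-a)^2+\beta-p(a)}.$$ If $|C|=\frac{(\beta-p(a))|V|}{p_2(r-a)^2+\beta-p(a)}$, then ${\bf 1}_C$ is a perfect $2$-coloring of $G$.
   Context: Let $M=M(G)$ be the adjacency matrix and $M_2(G)$ the distance-$2$ adjacency matrix (entry $1$ iff the vertices are at graph distance exactly $2$). $G$ is amply regular with polynomial $p$ if $M_2(G)=p(M)=p_2M^2+p_1M+p_0I$; such a graph is $r$-regular with $r=-p_0/p_2$. For $S\subseteq V$, $\sigma(S)=(M{\bf 1}_S,{\bf 1}_S)/|S|$ (average internal degree) and $\sigma_2(S)=(M_2(G){\bf 1}_S,{\bf 1}_S)/|S|$. ${\bf 1}_C$ is a perfect $2$-coloring if the partition $\{C,V\setminus C\}$ is equitable, i.e. there are integers $q_{ij}$ such that every vertex of the $i$-th part has exactly $q_{ij}$ neighbors in the $j$-th part.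
   Formalization: It is additionally assumed that p_2>0 (automatic if some vertices are at distance 2; for disjoint unions of complete graphs p may be rescaled by a negative factor and the bound can fail) and that the denominator p_2(r-a)^2+β-p(a) is nonzero (otherwise the fraction is 0/0). *)

theory Defs
  imports "HOL-Analysis.Analysis" "HOL-Library.Extended_Nat" "HOL-Computational_Algebra.Polynomial"
begin

text \<open>A finite simple graph is a symmetric irreflexive relation on a finite vertex type
  (so V is \<open>UNIV\<close>). Connectedness is not assumed: vertices in different components are at
  distance \<open>\<infinity>\<close>, as the infimum of the empty set.\<close>

definition gdist :: "('v \<Rightarrow> 'v \<Rightarrow> bool) \<Rightarrow> 'v \<Rightarrow> 'v \<Rightarrow> enat" where
  "gdist E u v = (INF n \<in> {n. (E ^^ n) u v}. enat n)"

definition adj_matrix :: "('v::finite \<Rightarrow> 'v \<Rightarrow> bool) \<Rightarrow> real^'v^'v" where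
  "adj_matrix E = (\<chi> u v. if E u v then 1 else 0)"

definition adj2_matrix :: "('v::finite \<Rightarrow> 'v \<Rightarrow> bool) \<Rightarrow> real^'v^'v" where
  "adj2_matrix E = (\<chi> u v. if gdist E u v = 2 then 1 else 0)"

definition amply_regular :: "('v::finite \<Rightarrow> 'v \<Rightarrow> bool) \<Rightarrow> real \<Rightarrow> real \<Rightarrow> real \<Rightarrow> bool" where
  "amply_regular E p2 p1 p0 \<longleftrightarrow>
     adj2_matrix E = p2 *\<^sub>R (adj_matrix E ** adj_matrix E) + p1 *\<^sub>R adj_matrix E + p0 *\<^sub>R mat 1"

definition regular_graph :: "('v::finite \<Rightarrow> 'v \<Rightarrow> bool) \<Rightarrow> nat \<Rightarrow> bool" where
  "regular_graph E r \<longleftrightarrow> (\<forall>v. card {w. E v w} = r)"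

definition ind_vec :: "'v::finite set \<Rightarrow> real^'v" where
  "ind_vec S = (\<chi> v. indicator S v)"

definition sigma1 :: "('v::finite \<Rightarrow> 'v \<Rightarrow> bool) \<Rightarrow> 'v set \<Rightarrow> real" where
  "sigma1 E S = ((adj_matrix E *v ind_vec S) \<bullet> ind_vec S) / real (card S)"

definition sigma2 :: "('v::finite \<Rightarrow> 'v \<Rightarrow> bool) \<Rightarrow> 'v set \<Rightarrow> real" where
  "sigma2 E S = ((adj2_matrix E *v ind_vec S) \<bullet> ind_vec S) / real (card S)"

definition equitable :: "('v::finite \<Rightarrow> 'v \<Rightarrow> bool) \<Rightarrow> 'v set set \<Rightarrow> bool" where
  "equitable E P \<longleftrightarrow>
     (\<exists>q :: 'v set \<Rightarrow> 'v set \<Rightarrow> int. \<forall>A\<in>P. \<forall>B\<in>P. \<forall>v\<in>A. int (card {w \<in> B. E v w}) = q A B)"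

text \<open>The coloring is the characteristic function of \<open>C\<close>, given here by \<open>C\<close> itself.\<close>

definition perfect_2_coloring :: "('v::finite \<Rightarrow> 'v \<Rightarrow> bool) \<Rightarrow> 'v set \<Rightarrow> bool" where
  "perfect_2_coloring E C \<longleftrightarrow> equitable E {C, UNIV - C}"

text \<open>The sign of the leading coefficient is forced unless the graph is a disjoint union of
  complete graphs, where the distance-2 matrix vanishes and any multiple of an annihilating
  quadratic satisfies the definition.\<close>

lemma amply_regular_leading_coeff_pos:
  assumes "amply_regular E p2 p1 p0" and d: "gdist E u v = 2"
  shows "p2 > 0"
proof -
  have le: "gdist E u v \<le> enat n" if "(E ^^ n) u v" for n
    unfolding gdist_def using that by (auto intro: INF_lower)
  have ne: "u \<noteq> v"
    using le[of 0] d by (auto simp flip: zero_enat_def)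
  have nadj: "\<not> E u v"
  proof
    assume "E u v"
    then have "gdist E u v \<le> enat 1" by (intro le) (auto simp: relcompp_apply)
    then show False using d by (simp add: numeral_eq_enat)
  qed
  have "adj2_matrix E $ u $ v = p2 * (adj_matrix E ** adj_matrix E) $ u $ v"
    using assms(1) ne nadj unfolding amply_regular_def by (simp add: adj_matrix_def mat_def)
  then have "1 = p2 * (adj_matrix E ** adj_matrix E) $ u $ v"
    using d by (simp add: adj2_matrix_def)
  moreover have "(adj_matrix E ** adj_matrix E) $ u $ v \<ge> 0"
    by (auto simp: adj_matrix_def matrix_matrix_mult_def intro!: sum_nonneg)
  ultimately show ?thesis
    by (metis mult_nonpos_nonneg not_less not_one_le_zero)
qed

end

theory Submission
  imports Defs
begin

text \<open>Let \<open>d v\<close> be the number of neighbors of \<open>v\<close> in \<open>C\<close>. Its mean on \<open>C\<close> is \<open>a = \<sigma>(C)\<close>, double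
  counting gives the sum \<open>(r - a) |C|\<close> on the complement, and the relation \<open>M\<^sub>2 = p(M)\<close> expresses
  the sum of its squares through \<open>\<sigma>\<^sub>2(C)\<close>. The bound says that the variance of \<open>d\<close> on \<open>C\<close> plus its
  variance on the complement is nonnegative; equality means that both variances vanish, i.e. that
  the partition is equitable.\<close>

text \<open>The junk value \<open>mean f {} = 0\<close> lets the complement of \<open>C\<close> be empty.\<close>

definition mean :: "('a \<Rightarrow> real) \<Rightarrow> 'a set \<Rightarrow> real" where
  "mean f A = (\<Sum>x\<in>A. f x) / real (card A)"

definition sum_sq_dev :: "('a \<Rightarrow> real) \<Rightarrow> 'a set \<Rightarrow> real" where
  "sum_sq_dev f A = (\<Sum>x\<in>A. (f x - mean f A)\<^sup>2)"

lemma sum_eq_mean_mult_card: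
  assumes "finite A"
  shows "(\<Sum>x\<in>A. f x) = mean f A * real (card A)"
  using assms by (cases "A = {}") (simp_all add: mean_def)

lemma sum_squares_eq_sum_sq_dev:
  assumes "finite A"
  shows "(\<Sum>x\<in>A. (f x)\<^sup>2) = sum_sq_dev f A + (mean f A)\<^sup>2 * real (card A)"
proof -
  let ?m = "mean f A"
  have "sum_sq_dev f A = (\<Sum>x\<in>A. (f x)\<^sup>2) - 2 * ?m * (\<Sum>x\<in>A. f x) + ?m\<^sup>2 * real (card A)"
    unfolding sum_sq_dev_def
    by (simp add: power2_diff sum.distrib sum_subtractf flip: sum_distrib_left sum_distrib_right)
  then show ?thesis
    by (simp add: sum_eq_mean_mult_card[OF assms] power2_eq_square)
qed

lemma sum_sq_dev_nonneg: "0 \<le> sum_sq_dev f A"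
  by (simp add: sum_sq_dev_def sum_nonneg)

lemma sum_sq_dev_eq_0_iff:
  assumes "finite A"
  shows "sum_sq_dev f A = 0 \<longleftrightarrow> f constant_on A"
proof
  assume "sum_sq_dev f A = 0"
  then show "f constant_on A"
    using assms by (auto simp: sum_sq_dev_def sum_nonneg_eq_0_iff constant_on_def)
next
  assume "f constant_on A"
  then obtain y where y: "f x = y" if "x \<in> A" for x
    by (auto simp: constant_on_def)
  have "mean f A = y" if "x \<in> A" for x
    using assms that by (auto simp: mean_def y)
  with y show "sum_sq_dev f A = 0"
    by (simp add: sum_sq_dev_def)
qed

definition nbrs_in :: "('v::finite \<Rightarrow> 'v \<Rightarrow> bool) \<Rightarrow> 'v set \<Rightarrow> 'v \<Rightarrow> nat" where
  "nbrs_in E S v = card {w \<in> S. E v w}"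

lemma adj_matrix_mult_ind_vec:
  "(adj_matrix E *v ind_vec S) $ v = real (nbrs_in E S v)"
proof -
  have "(adj_matrix E *v ind_vec S) $ v = (\<Sum>w\<in>UNIV. indicator {w \<in> S. E v w} w)"
    unfolding matrix_vector_mult_def adj_matrix_def ind_vec_def vec_lambda_beta
    by (intro sum.cong) (auto simp: indicator_def)
  then show ?thesis
    by (simp add: indicator_def nbrs_in_def)
qed

lemma inner_ind_vec: "x \<bullet> ind_vec S = (\<Sum>v\<in>S. x $ v)"
  by (simp add: inner_vec_def ind_vec_def)

lemma inner_adj_matrix_commute:
  assumes "symp E"
  shows "(adj_matrix E *v x) \<bullet> y = x \<bullet> (adj_matrix E *v y)"
proof -
  have "transpose (adj_matrix E) = adj_matrix E"
    using sympD[OF assms] by (auto simp: transpose_def adj_matrix_def vec_eq_iff)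
  then show ?thesis
    by (metis dot_lmul_matrix vector_transpose_matrix)
qed

lemma amply_regular_inner_adj2_matrix:
  assumes "symp E" and "amply_regular E p2 p1 p0"
  shows "(adj2_matrix E *v x) \<bullet> x =
    p2 * (norm (adj_matrix E *v x))\<^sup>2 + p1 * ((adj_matrix E *v x) \<bullet> x) + p0 * (norm x)\<^sup>2"
proof -
  let ?M = "adj_matrix E"
  have "(adj2_matrix E *v x) \<bullet> x =
      p2 * ((?M *v (?M *v x)) \<bullet> x) + p1 * ((?M *v x) \<bullet> x) + p0 * (x \<bullet> x)"
    using assms(2) unfolding amply_regular_def
    by (simp add: matrix_vector_mult_add_rdistrib inner_add_left matrix_vector_mul_assoc
        flip: scaleR_matrix_vector_assoc)
  then show ?thesis
    by (simp add: inner_adj_matrix_commute[OF assms(1)] power2_norm_eq_inner)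
qed

lemma sigma1_eq_mean: "sigma1 E S = mean (nbrs_in E S) S"
  by (simp add: sigma1_def mean_def inner_ind_vec adj_matrix_mult_ind_vec)

lemma amply_regular_sigma2:
  assumes "symp E" and "amply_regular E p2 p1 p0"
  shows "sigma2 E S * real (card S) =
    p2 * (\<Sum>v\<in>UNIV. (real (nbrs_in E S v))\<^sup>2) + (p1 * sigma1 E S + p0) * real (card S)"
proof -
  have "sigma2 E S * real (card S) = (adj2_matrix E *v ind_vec S) \<bullet> ind_vec S"
    by (cases "S = {}") (simp_all add: sigma2_def inner_ind_vec)
  moreover have "(adj_matrix E *v ind_vec S) \<bullet> ind_vec S = sigma1 E S * real (card S)"
    by (cases "S = {}") (simp_all add: sigma1_def inner_ind_vec)
  moreover have "(norm (adj_matrix E *v ind_vec S))\<^sup>2 = (\<Sum>v\<in>UNIV. (real (nbrs_in E S v))\<^sup>2)"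
    unfolding power2_norm_eq_inner inner_vec_def adj_matrix_mult_ind_vec
    by (simp add: power2_eq_square)
  moreover have "(norm (ind_vec S))\<^sup>2 = real (card S)"
    unfolding power2_norm_eq_inner inner_ind_vec by (simp add: ind_vec_def)
  ultimately show ?thesis
    using amply_regular_inner_adj2_matrix[OF assms, of "ind_vec S"] by (simp add: algebra_simps)
qed

lemma sum_UNIV_split: "(\<Sum>v\<in>UNIV. f v) = (\<Sum>v\<in>S. f v) + (\<Sum>v\<in>-S. f v)"
  for f :: "'v::finite \<Rightarrow> 'a::comm_monoid_add"
  using sum.subset_diff[of S UNIV f] by (simp add: Compl_eq_Diff_UNIV add.commute)

lemma sigma2_minus_poly_sigma1:
  assumes "symp E" and "amply_regular E p2 p1 p0"
  shows "(sigma2 E S - poly [:p0, p1, p2:] (sigma1 E S)) * real (card S) =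
    p2 * (sum_sq_dev (nbrs_in E S) S + (\<Sum>v\<in>-S. (real (nbrs_in E S v))\<^sup>2))"
proof -
  have "(\<Sum>v\<in>UNIV. (real (nbrs_in E S v))\<^sup>2) = sum_sq_dev (nbrs_in E S) S +
      (sigma1 E S)\<^sup>2 * real (card S) + (\<Sum>v\<in>-S. (real (nbrs_in E S v))\<^sup>2)"
    by (simp add: sum_UNIV_split[of _ S] sum_squares_eq_sum_sq_dev sigma1_eq_mean)
  with amply_regular_sigma2[OF assms, of S] show ?thesis
    by (simp add: algebra_simps power2_eq_square)
qed

lemma poly_sigma1_le_sigma2:
  assumes "symp E" and "amply_regular E p2 p1 p0" and "p2 \<ge> 0" and "S \<noteq> {}"
  shows "poly [:p0, p1, p2:] (sigma1 E S) \<le> sigma2 E S"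
proof -
  have "0 \<le> p2 * (sum_sq_dev (nbrs_in E S) S + (\<Sum>v\<in>-S. (real (nbrs_in E S v))\<^sup>2))"
    using assms(3) by (intro mult_nonneg_nonneg add_nonneg_nonneg sum_sq_dev_nonneg sum_nonneg) auto
  also have "\<dots> = (sigma2 E S - poly [:p0, p1, p2:] (sigma1 E S)) * real (card S)"
    using sigma2_minus_poly_sigma1[OF assms(1,2)] by simp
  finally show ?thesis
    using assms(4) by (simp add: zero_le_mult_iff card_eq_0_iff)
qed

lemma sum_nbrs_in_UNIV:
  assumes "symp E" and "regular_graph E r"
  shows "(\<Sum>v\<in>UNIV. real (nbrs_in E S v)) = real r * real (card S)"
proof -
  have "(\<Sum>v\<in>UNIV. real (nbrs_in E S v)) = (adj_matrix E *v ind_vec S) \<bullet> ind_vec UNIV"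
    by (simp add: inner_ind_vec adj_matrix_mult_ind_vec)
  also have "\<dots> = (adj_matrix E *v ind_vec UNIV) \<bullet> ind_vec S"
    by (metis assms(1) inner_adj_matrix_commute inner_commute)
  also have "\<dots> = real r * real (card S)"
    using assms(2) by (simp add: inner_ind_vec adj_matrix_mult_ind_vec nbrs_in_def regular_graph_def)
  finally show ?thesis .
qed

lemma sum_nbrs_in_Compl:
  assumes "symp E" and "regular_graph E r"
  shows "(\<Sum>v\<in>-S. real (nbrs_in E S v)) = (real r - sigma1 E S) * real (card S)"
  using sum_nbrs_in_UNIV[OF assms, of S]
  by (simp add: sum_UNIV_split[of _ S] sum_eq_mean_mult_card[of S] sigma1_eq_mean algebra_simps)

text \<open>The factor \<open>card (-S)\<close> turns the squared mean on the complement into the square of the sum,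
  which regularity determines.\<close>

lemma sigma2_gap_minus_sigma1_gap:
  assumes "symp E" and "amply_regular E p2 p1 p0" and "regular_graph E r"
  shows "real (card S) * ((sigma2 E S - poly [:p0, p1, p2:] (sigma1 E S)) * real (card (-S))
      - p2 * (real r - sigma1 E S)\<^sup>2 * real (card S)) =
    p2 * real (card (-S)) * (sum_sq_dev (nbrs_in E S) S + sum_sq_dev (nbrs_in E S) (-S))"
    (is "?c * (?s * ?m - p2 * ?e\<^sup>2 * ?c) = p2 * ?m * (?V + ?V')")
proof -
  let ?b = "mean (nbrs_in E S) (-S)"
  have "?s * ?c = p2 * (?V + ?V' + ?b\<^sup>2 * ?m)"
    using sigma2_minus_poly_sigma1[OF assms(1,2), of S]
    by (simp add: sum_squares_eq_sum_sq_dev add.assoc)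
  then have "?m * (?s * ?c) = p2 * ?m * (?V + ?V') + p2 * (?b * ?m)\<^sup>2"
    by (simp add: algebra_simps power2_eq_square)
  moreover have "?b * ?m = ?e * ?c"
    using sum_nbrs_in_Compl[OF assms(1,3), of S] by (simp add: sum_eq_mean_mult_card)
  ultimately show ?thesis
    by algebra
qed

lemma equitable_iff_constant_on:
  "equitable E P \<longleftrightarrow> (\<forall>A\<in>P. \<forall>B\<in>P. nbrs_in E B constant_on A)"
proof
  assume "equitable E P"
  then obtain q where "\<forall>A\<in>P. \<forall>B\<in>P. \<forall>v\<in>A. int (nbrs_in E B v) = q A B"
    by (auto simp: equitable_def nbrs_in_def)
  then have "\<forall>A\<in>P. \<forall>B\<in>P. \<forall>v\<in>A. nbrs_in E B v = nat (q A B)"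
    by (metis nat_int)
  then show "\<forall>A\<in>P. \<forall>B\<in>P. nbrs_in E B constant_on A"
    unfolding constant_on_def by blast
next
  assume "\<forall>A\<in>P. \<forall>B\<in>P. nbrs_in E B constant_on A"
  then obtain q where "\<forall>A\<in>P. \<forall>B\<in>P. \<forall>v\<in>A. nbrs_in E B v = q A B"
    unfolding constant_on_def by metis
  then show "equitable E P"
    unfolding equitable_def nbrs_in_def by (intro exI[of _ "\<lambda>A B. int (q A B)"]) simp
qed

lemma nbrs_in_Compl:
  assumes "regular_graph E r"
  shows "nbrs_in E (-S) v = r - nbrs_in E S v"
proof -
  have "{w \<in> -S. E v w} = {w. E v w} - {w \<in> S. E v w}"
    by auto
  then show ?thesis
    using assms by (simp add: nbrs_in_def regular_graph_def card_Diff_subset subset_eq)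
qed

lemma regular_perfect_2_coloring_iff:
  assumes "regular_graph E r"
  shows "perfect_2_coloring E S \<longleftrightarrow> nbrs_in E S constant_on S \<and> nbrs_in E S constant_on (-S)"
proof -
  have "nbrs_in E (-S) constant_on A" if "nbrs_in E S constant_on A" for A
    using that by (auto simp: constant_on_def nbrs_in_Compl[OF assms])
  then show ?thesis
    by (auto simp: perfect_2_coloring_def equitable_iff_constant_on simp flip: Compl_eq_Diff_UNIV)
qed

lemma regular_perfect_2_coloring_iff_sum_sq_dev:
  assumes "regular_graph E r"
  shows "perfect_2_coloring E S \<longleftrightarrow>
    sum_sq_dev (nbrs_in E S) S + sum_sq_dev (nbrs_in E S) (-S) = 0"
proof -
  have "(\<lambda>v. real (nbrs_in E S v)) constant_on A \<longleftrightarrow> nbrs_in E S constant_on A" for A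
    unfolding constant_on_def by (metis of_nat_eq_iff)
  then show ?thesis
    by (simp add: regular_perfect_2_coloring_iff[OF assms] sum_sq_dev_eq_0_iff
        add_nonneg_eq_0_iff sum_sq_dev_nonneg)
qed

lemma regular_perfect_2_coloring_UNIV:
  assumes "regular_graph E r"
  shows "perfect_2_coloring E UNIV"
  using assms
  by (auto simp: regular_perfect_2_coloring_iff constant_on_def nbrs_in_def regular_graph_def)

lemma sigma1_gap_le_sigma2_gap:
  assumes "symp E" and "amply_regular E p2 p1 p0" and "p2 \<ge> 0" and "regular_graph E r"
    and "S \<noteq> {}"
  shows "p2 * (real r - sigma1 E S)\<^sup>2 * real (card S)
    \<le> (sigma2 E S - poly [:p0, p1, p2:] (sigma1 E S)) * real (card (-S))" (is "?l \<le> ?u")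
proof -
  have "0 \<le> real (card S) * (?u - ?l)"
    unfolding sigma2_gap_minus_sigma1_gap[OF assms(1,2,4)]
    using assms(3) by (simp add: sum_sq_dev_nonneg)
  then show ?thesis
    using assms(5) by (simp add: zero_le_mult_iff card_eq_0_iff)
qed

lemma sigma1_gap_eq_sigma2_gap_iff:
  assumes "symp E" and "amply_regular E p2 p1 p0" and "p2 \<noteq> 0" and "regular_graph E r"
    and "S \<noteq> {}"
  shows "p2 * (real r - sigma1 E S)\<^sup>2 * real (card S)
      = (sigma2 E S - poly [:p0, p1, p2:] (sigma1 E S)) * real (card (-S))
    \<longleftrightarrow> perfect_2_coloring E S" (is "?l = ?u \<longleftrightarrow> _")
proof -
  have "?l = ?u \<longleftrightarrow> real (card S) * (?u - ?l) = 0"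
    using assms(5) by (auto simp: card_eq_0_iff)
  also have "\<dots> \<longleftrightarrow> -S = {} \<or> perfect_2_coloring E S"
    unfolding sigma2_gap_minus_sigma1_gap[OF assms(1,2,4)]
    using assms(3) by (simp add: regular_perfect_2_coloring_iff_sum_sq_dev[OF assms(4)])
  also have "\<dots> \<longleftrightarrow> perfect_2_coloring E S"
    using regular_perfect_2_coloring_UNIV[OF assms(4)] by (metis Compl_empty_eq double_compl)
  finally show ?thesis .
qed

theorem theorem3:
  fixes E :: "'v::finite \<Rightarrow> 'v \<Rightarrow> bool"
    and C :: "'v set"
    and p2 p1 p0 a \<beta> :: real
    and r :: nat
  assumes "symp E" and "irreflp E"
    and "amply_regular E p2 p1 p0"
    and "p2 > 0"
    and "regular_graph E r"
    and "C \<noteq> {}"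
    and "sigma1 E C = a"
    and "sigma2 E C \<le> \<beta>"
    and "p2 * (real r - a)\<^sup>2 + \<beta> - poly [:p0, p1, p2:] a \<noteq> 0"
  shows "real (card C) \<le> (\<beta> - poly [:p0, p1, p2:] a) * real CARD('v) / (p2 * (real r - a)\<^sup>2 + \<beta> - poly [:p0, p1, p2:] a)
    \<and> (real (card C) = (\<beta> - poly [:p0, p1, p2:] a) * real CARD('v) / (p2 * (real r - a)\<^sup>2 + \<beta> - poly [:p0, p1, p2:] a)
        \<longrightarrow> perfect_2_coloring E C)"
    (is "?c \<le> ?t * ?n / ?D \<and> (_ \<longrightarrow> _)")
proof -
  let ?X = "p2 * (real r - a)\<^sup>2" and ?m = "real (card (-C))"
  let ?s = "sigma2 E C - poly [:p0, p1, p2:] a"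
  have "0 \<le> ?s" "?s \<le> ?t" "0 \<le> ?X"
    using poly_sigma1_le_sigma2[OF assms(1,3) _ assms(6)] assms(4,7,8) by auto
  then have D_pos: "?D > 0"
    using assms(9) by linarith
  have lower: "?X * ?c \<le> ?s * ?m"
    using sigma1_gap_le_sigma2_gap[OF assms(1,3) _ assms(5,6)] assms(4,7) by simp
  have upper: "?s * ?m \<le> ?t * ?m"
    using \<open>?s \<le> ?t\<close> by (intro mult_right_mono) auto
  have "?n = ?c + ?m"
    using sum_UNIV_split[of "\<lambda>_. 1 :: real" C] by simp
  then have diff: "?t * ?n - ?c * ?D = ?t * ?m - ?X * ?c"
    by algebra
  have "?c \<le> ?t * ?n / ?D"
    using lower upper diff D_pos by (simp only: pos_le_divide_eq)
  moreover have "perfect_2_coloring E C" if "?c = ?t * ?n / ?D"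
  proof -
    have "?X * ?c = ?s * ?m"
      using that D_pos lower upper diff by (simp add: eq_divide_eq)
    then show ?thesis
      using sigma1_gap_eq_sigma2_gap_iff[OF assms(1,3) _ assms(5,6)] assms(4,7) by simp
  qed
  ultimately show ?thesis
    by blast
qed

end
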